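(* Let $n\ge 1$ and let $\{a_i\}_{i=1}^n$ and $\{b_i\}_{i=1}^n$ be $n$-tuples of positive real numbers such that, for some real numbers $p,q>0$, $$p\ge \frac{a_i}{b_i}\ge q,\qquad i=1,\dots,n.$$ Then $$\sum_{i=1}^n a_i^{\downarrow}b_i^{\downarrow}\le \frac{p+q}{2\sqrt{pq}}\sum_{i=1}^n a_ib_i .$$
   Context: For an $n$-tuple of real numbers $\{a_i\}_{i=1}^n$, $\{a_i^{\downarrow}\}_{i=1}^n$ denotes its nonincreasing rearrangement, i.e. the same numbers (with multiplicity) listed so that $a_1^{\downarrow}\ge a_2^{\downarrow}\ge\dots\ge a_n^{\downarrow}$. *)

theory Defs
  imports Complex_Main "HOL-Library.Multiset"
begin

definition decreasing_rearrangement :: "'a::linorder list \<Rightarrow> 'a list" where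
  "decreasing_rearrangement xs = rev (sort xs)"

text \<open>\<^const>\<open>decreasing_rearrangement\<close> is characterised by listing the same entries, with
  multiplicity, in nonincreasing order.\<close>

lemma mset_decreasing_rearrangement [simp]:
  "mset (decreasing_rearrangement xs) = mset xs"
  by (simp add: decreasing_rearrangement_def)

lemma length_decreasing_rearrangement [simp]:
  "length (decreasing_rearrangement xs) = length xs"
  by (simp add: decreasing_rearrangement_def)

lemma sorted_wrt_decreasing_rearrangement:
  "sorted_wrt (\<ge>) (decreasing_rearrangement xs)"
  by (simp add: decreasing_rearrangement_def sorted_wrt_rev)

lemma decreasing_rearrangement_unique:
  assumes "mset ys = mset xs" and "sorted_wrt (\<ge>) ys"
  shows "ys = decreasing_rearrangement xs"
proof -
  have "sort xs = rev ys"
    using assms by (intro properties_for_sort) (simp_all add: sorted_wrt_rev)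
  then show ?thesis
    by (simp add: decreasing_rearrangement_def)
qed

end

theory Submission
  imports Defs
begin

text \<open>The ratio bounds give \<open>(a\<^sub>i - q b\<^sub>i)(p b\<^sub>i - a\<^sub>i) \<ge> 0\<close>, that is,
  \<open>a\<^sub>i\<^sup>2 + p q b\<^sub>i\<^sup>2 \<le> (p + q) a\<^sub>i b\<^sub>i\<close>. Sums of squares are invariant under rearrangement,
  so after summation the left-hand side may be written with the rearranged tuples, where AM-GM
  bounds it from below by \<open>2 sqrt(p q) \<Sum> a\<^sub>i\<^sup>\<down> b\<^sub>i\<^sup>\<down>\<close>.\<close>

text \<open>Both sums depend only on the multiset of entries, which sorting preserves.\<close>

lemma sum_nth_decreasing_rearrangement:
  fixes f :: "'a::linorder \<Rightarrow> 'b::comm_monoid_add"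
  assumes "length xs = n"
  shows "(\<Sum>i<n. f (decreasing_rearrangement xs ! i)) = (\<Sum>i<n. f (xs ! i))"
proof -
  have sum_nth: "(\<Sum>i<n. f (ys ! i)) = sum_mset (image_mset f (mset ys))"
    if "length ys = n" for ys
    using that
    unfolding mset_map[symmetric] sum_mset_sum_list
    by (simp add: sum_list_sum_nth atLeast0LessThan)
  show ?thesis
    using assms by (simp add: sum_nth)
qed

theorem theorem2p9:
  fixes n :: nat and a b :: "real list" and p q :: real
  assumes "n \<ge> 1"
    and "length a = n" and "length b = n"
    and "\<And>i. i < n \<Longrightarrow> a ! i > 0"
    and "\<And>i. i < n \<Longrightarrow> b ! i > 0"
    and "p > 0" and "q > 0"
    and "\<And>i. i < n \<Longrightarrow> p \<ge> a ! i / b ! i \<and> a ! i / b ! i \<ge> q"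
  shows "(\<Sum>i<n. decreasing_rearrangement a ! i * decreasing_rearrangement b ! i)
           \<le> (p + q) / (2 * sqrt (p * q)) * (\<Sum>i<n. a ! i * b ! i)"
proof -
  let ?a = "decreasing_rearrangement a" and ?b = "decreasing_rearrangement b"
  let ?s = "sqrt (p * q)"
  have s: "?s > 0" "?s\<^sup>2 = p * q"
    using \<open>p > 0\<close> \<open>q > 0\<close> by simp_all
  have "2 * ?s * (\<Sum>i<n. ?a ! i * ?b ! i) \<le> (\<Sum>i<n. (?a ! i)\<^sup>2 + p * q * (?b ! i)\<^sup>2)"
    unfolding sum_distrib_left
  proof (rule sum_mono)
    fix i
    \<comment> \<open>The weight \<open>?s\<close> is chosen so that its square is
      \<open>p * q\<close> and the cross term carries the factor \<open>2 * ?s\<close> of the target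
      denominator.\<close>
    have "0 \<le> (?a ! i - ?s * ?b ! i)\<^sup>2"
      by simp
    then show "2 * ?s * (?a ! i * ?b ! i) \<le> (?a ! i)\<^sup>2 + p * q * (?b ! i)\<^sup>2"
      unfolding power2_diff power_mult_distrib s(2) by (simp add: mult_ac)
  qed
  \<comment> \<open>\<open>a\<close> and \<open>b\<close> may be sorted by different permutations,
    so the sum is split and each sum of squares is rearranged on its own.\<close>
  also have "\<dots> = (\<Sum>i<n. (a ! i)\<^sup>2 + p * q * (b ! i)\<^sup>2)"
    using assms(2,3)
    by (simp add: sum.distrib sum_nth_decreasing_rearrangement[where f = "\<lambda>x. x\<^sup>2"]
        flip: sum_distrib_left)
  also have "\<dots> \<le> (p + q) * (\<Sum>i<n. a ! i * b ! i)"
    unfolding sum_distrib_left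
  proof (rule sum_mono)
    fix i assume "i \<in> {..<n}"
    then have "a ! i \<le> p * b ! i" "q * b ! i \<le> a ! i"
      using assms(5,8)[of i] by (simp_all add: field_simps)
    then have "0 \<le> (a ! i - q * b ! i) * (p * b ! i - a ! i)"
      by simp
    then show "(a ! i)\<^sup>2 + p * q * (b ! i)\<^sup>2 \<le> (p + q) * (a ! i * b ! i)"
      by (simp add: algebra_simps power2_eq_square)
  qed
  finally show ?thesis
    using s(1) by (simp add: field_simps)
qed

end
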